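(* Let $n\ge1$, $r\ge 1$, and let $\sigma_1,\dots,\sigma_r$ be pattern functions that are either all in $D=\{(ba),(a-cb),(b-ca),(c-ba),(a-ba),(b-ba)\}$ or all in $R=\{(ab),(a-bc),(b-ac),(c-ab),(a-ab),(b-ab)\}$. For $m\in\mathbb N^n$ let $$F(m)=F_{\sigma_1,\dots,\sigma_r}(m,q_1,\dots,q_r)=\sum_{w\in A^*_m}q_1^{\sigma_1(w)}\cdots q_r^{\sigma_r(w)}.$$ Then for every $m=(m_1,\dots,m_n)$ with all $m_i>0$, $$F(m)=\sum_{\emptyset\ne T\subseteq[n]}\ \Bigl(\prod_{j=1}^{|T|-1}\bigl(q_1^{e_{\sigma_1}(m,T,j)}\cdots q_r^{e_{\sigma_r}(m,T,j)}-1\bigr)\Bigr)F(m-\mathbf 1_T),$$ where the exponents $e_\sigma(m,T,j)$ are those listed in the context. The same recurrence holds for the joint distribution of the reversed statistics $\sigma_1^r,\dots,\sigma_r^r$, where $\sigma^r(w)=\sigma(w^r)$.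
   Context: $[n]=\{1,\dots,n\}$, $\mathbb N=\{0,1,2,\dots\}$. For $m\in\mathbb N^n$, $A^*_m$ is the set of all words in the alphabet $[n]$ containing exactly $m_i$ copies of the letter $i$ for each $i$. $\mathbf 1_T\in\{0,1\}^n$ is the indicator vector of $T$. Empty products equal $1$ and empty sums equal $0$. $w^r=w_\ell\cdots w_1$ is the reversal of $w=w_1\cdots w_\ell$. Pattern functions: $(ba)(w)=|\{i:w_i>w_{i+1}\}|$, $(ab)(w)=|\{i:w_i<w_{i+1}\}|$, and $(x-yz)(w)$ is the number of pairs $(i,j)$ with $1\le i<j<\ell$ such that $w_i,w_j,w_{j+1}$ are order-isomorphic to $x,y,z$ (where $a<b<c$; equal pattern letters correspond to equal word letters, distinct ones to distinct word letters). For example $(a-cb)$ counts pairs with $w_i<w_{j+1}<w_j$ and $(b-ab)$ counts pairs with $w_j<w_{j+1}=w_i$. Exponents, for $T=\{t_1>t_2>\cdots>t_{|T|}\}$ and $1\le j\le |T|-1$: $e_{(ba)}=e_{(ab)}=1$; $e_{(a-cb)}=m_1+\cdots+m_{t_{j+1}-1}-|T|+j+1$; $e_{(b-ca)}=e_{(b-ac)}=m_{t_{j+1}+1}+\cdots+m_{t_j-1}$; $e_{(c-ba)}=m_{t_j+1}+\cdots+m_n$; $e_{(a-ba)}=e_{(a-ab)}=m_{t_{j+1}}-1$; $e_{(b-ba)}=e_{(b-ab)}=m_{t_j}-1$; $e_{(a-bc)}=m_1+\cdots+m_{t_{j+1}-1}$; $e_{(c-ab)}=m_{t_j+1}+\cdots+m_n-j+1$.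 *)

theory Defs
  imports Main
begin

text \<open>
  The twelve pattern functions. The statement refers to them by name, since the exponents
  below depend on the pattern; an underscore stands for the dash, so \<open>A_CB\<close> is \<open>(a-cb)\<close>.
\<close>

datatype pattern =
    BA | A_CB | B_CA | C_BA | A_BA | B_BA
  | AB | A_BC | B_AC | C_AB | A_AB | B_AB

definition patterns_D :: "pattern set" where
  "patterns_D = {BA, A_CB, B_CA, C_BA, A_BA, B_BA}"

definition patterns_R :: "pattern set" where
  "patterns_R = {AB, A_BC, B_AC, C_AB, A_AB, B_AB}"

definition order_iso :: "nat list \<Rightarrow> nat list \<Rightarrow> bool" where
  "order_iso xs ys \<longleftrightarrow> length xs = length ys \<and>
     (\<forall>i < length xs. \<forall>j < length xs. xs ! i < xs ! j \<longleftrightarrow> ys ! i < ys ! j)"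

text \<open>Words are lists, so the letter \<open>w\<^sub>i\<close> is \<open>w ! (i - 1)\<close>: positions below start at 0.\<close>

definition adjacent_occurrences :: "nat \<Rightarrow> nat \<Rightarrow> nat list \<Rightarrow> nat" where
  "adjacent_occurrences x y w =
     card {i. Suc i < length w \<and> order_iso [w ! i, w ! Suc i] [x, y]}"

definition dashed_occurrences :: "nat \<Rightarrow> nat \<Rightarrow> nat \<Rightarrow> nat list \<Rightarrow> nat" where
  "dashed_occurrences x y z w =
     card {(i, j). i < j \<and> Suc j < length w \<and> order_iso [w ! i, w ! j, w ! Suc j] [x, y, z]}"

text \<open>The pattern letters \<open>a < b < c\<close> are encoded as \<open>1 < 2 < 3\<close>.\<close>

fun pattern_count :: "pattern \<Rightarrow> nat list \<Rightarrow> nat" where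
  "pattern_count BA = adjacent_occurrences 2 1"
| "pattern_count A_CB = dashed_occurrences 1 3 2"
| "pattern_count B_CA = dashed_occurrences 2 3 1"
| "pattern_count C_BA = dashed_occurrences 3 2 1"
| "pattern_count A_BA = dashed_occurrences 1 2 1"
| "pattern_count B_BA = dashed_occurrences 2 2 1"
| "pattern_count AB = adjacent_occurrences 1 2"
| "pattern_count A_BC = dashed_occurrences 1 2 3"
| "pattern_count B_AC = dashed_occurrences 2 1 3"
| "pattern_count C_AB = dashed_occurrences 3 1 2"
| "pattern_count A_AB = dashed_occurrences 1 1 2"
| "pattern_count B_AB = dashed_occurrences 2 1 2"

text \<open>
  A vector \<open>m\<close> in \<open>\<nat>\<^sup>n\<close> is a function on \<open>nat\<close> of which only the values on \<open>{1..n}\<close> are used.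
\<close>

definition words :: "nat \<Rightarrow> (nat \<Rightarrow> nat) \<Rightarrow> nat list set" where
  "words n m = {w. set w \<subseteq> {1..n} \<and> (\<forall>i\<in>{1..n}. count_list w i = m i)}"

text \<open>So the sum over \<open>words n m\<close> below is a genuine finite sum.\<close>

lemma finite_words: "finite (words n m)"
proof (rule finite_subset)
  show "words n m \<subseteq> {w. set w \<subseteq> {1..n} \<and> length w = (\<Sum>i\<in>{1..n}. m i)}"
  proof
    fix w assume w: "w \<in> words n m"
    then have "(\<Sum>i\<in>{1..n}. m i) = (\<Sum>i\<in>{1..n}. count_list w i)"
      by (intro sum.cong) (auto simp: words_def)
    also have "\<dots> = length w"
      using w by (intro sum_count_set) (auto simp: words_def)
    finally show "w \<in> {w. set w \<subseteq> {1..n} \<and> length w = (\<Sum>i\<in>{1..n}. m i)}"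
      using w by (simp add: words_def)
  qed
qed (simp add: finite_lists_length_eq)

text \<open>
  The formal variables \<open>q\<^sub>1, \<dots>, q\<^sub>r\<close> are represented by elements of an arbitrary commutative
  ring; taking the polynomial ring gives the identity of polynomials.
\<close>

definition joint_distribution ::
  "nat \<Rightarrow> nat \<Rightarrow> (nat \<Rightarrow> nat list \<Rightarrow> nat) \<Rightarrow> (nat \<Rightarrow> 'a::comm_ring_1) \<Rightarrow> (nat \<Rightarrow> nat) \<Rightarrow> 'a" where
  "joint_distribution n r s q m = (\<Sum>w\<in>words n m. \<Prod>k=1..r. q k ^ s k w)"

text \<open>The element \<open>t\<^sub>j\<close> of \<open>T = {t\<^sub>1 > t\<^sub>2 > \<dots>}\<close>, with \<open>j\<close> starting at 1.\<close>

definition nth_largest :: "nat set \<Rightarrow> nat \<Rightarrow> nat" where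
  "nth_largest T j = rev (sorted_list_of_set T) ! (j - 1)"

text \<open>
  Subtraction on \<open>nat\<close> is never truncated here if \<open>m\<close> is positive on \<open>{1..n}\<close>, \<open>T \<subseteq> {1..n}\<close> and
  \<open>1 \<le> j < card T\<close>: there are \<open>card T - j - 1\<close> elements of \<open>T\<close> below \<open>t\<^bsub>j+1\<^esub>\<close> and
  \<open>j - 1\<close> above \<open>t\<^sub>j\<close>. The summands are ordered so that the subtraction comes last.
\<close>

fun exponent :: "pattern \<Rightarrow> nat \<Rightarrow> (nat \<Rightarrow> nat) \<Rightarrow> nat set \<Rightarrow> nat \<Rightarrow> nat" where
  "exponent BA n m T j = 1"
| "exponent AB n m T j = 1"
| "exponent A_CB n m T j = (\<Sum>i\<in>{1..<nth_largest T (j + 1)}. m i) + j + 1 - card T"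
| "exponent B_CA n m T j = (\<Sum>i\<in>{nth_largest T (j + 1)<..<nth_largest T j}. m i)"
| "exponent B_AC n m T j = (\<Sum>i\<in>{nth_largest T (j + 1)<..<nth_largest T j}. m i)"
| "exponent C_BA n m T j = (\<Sum>i\<in>{nth_largest T j<..n}. m i)"
| "exponent A_BA n m T j = m (nth_largest T (j + 1)) - 1"
| "exponent A_AB n m T j = m (nth_largest T (j + 1)) - 1"
| "exponent B_BA n m T j = m (nth_largest T j) - 1"
| "exponent B_AB n m T j = m (nth_largest T j) - 1"
| "exponent A_BC n m T j = (\<Sum>i\<in>{1..<nth_largest T (j + 1)}. m i)"
| "exponent C_AB n m T j = (\<Sum>i\<in>{nth_largest T j<..n}. m i) + 1 - j"

end

theory Submission
  imports Defs
begin

text \<open>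
  Appending a letter \<open>b\<close> to \<open>v @ [a]\<close> raises each statistic in \<open>D\<close> by a number that
  depends only on the content of \<open>v\<close> and on \<open>a, b\<close>, and that vanishes unless \<open>a > b\<close> (for \<open>R\<close>, unless
  \<open>a < b\<close>). So the weight of a word is a product of factors \<open>x\<close>, one for each descent. Writing
  \<open>x = (x - 1) + 1\<close> successively from the right along the last decreasing run gives a sum over the
  nonempty decreasing suffixes of the word: each descent inside the suffix contributes \<open>x - 1\<close>, the
  step into the suffix contributes \<open>1\<close>, and the remaining prefix keeps its full weight. The suffix is
  the set \<open>T\<close>, and the prefix runs over all words of content \<open>m - 1\<^sub>T\<close>.
\<close>

section \<open>Increments of the pattern counts\<close>

fun appended_occurrences :: "pattern \<Rightarrow> nat list \<Rightarrow> nat \<Rightarrow> nat \<Rightarrow> nat" where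
  "appended_occurrences BA v a b = of_bool (b < a)"
| "appended_occurrences A_CB v a b = length (filter (\<lambda>x. x < b \<and> b < a) v)"
| "appended_occurrences B_CA v a b = length (filter (\<lambda>x. b < x \<and> x < a) v)"
| "appended_occurrences C_BA v a b = length (filter (\<lambda>x. b < a \<and> a < x) v)"
| "appended_occurrences A_BA v a b = length (filter (\<lambda>x. x = b \<and> b < a) v)"
| "appended_occurrences B_BA v a b = length (filter (\<lambda>x. x = a \<and> b < a) v)"
| "appended_occurrences AB v a b = of_bool (a < b)"
| "appended_occurrences A_BC v a b = length (filter (\<lambda>x. x < a \<and> a < b) v)"
| "appended_occurrences B_AC v a b = length (filter (\<lambda>x. a < x \<and> x < b) v)"
| "appended_occurrences C_AB v a b = length (filter (\<lambda>x. a < b \<and> b < x) v)"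
| "appended_occurrences A_AB v a b = length (filter (\<lambda>x. x = a \<and> a < b) v)"
| "appended_occurrences B_AB v a b = length (filter (\<lambda>x. x = b \<and> a < b) v)"

text \<open>All earlier adjacent pairs read the same letters in both words; the only new position is
  \<open>length v\<close>.\<close>

lemma adjacent_occurrences_snoc:
  "adjacent_occurrences y z (v @ [a, b]) =
     adjacent_occurrences y z (v @ [a]) + of_bool (order_iso [a, b] [y, z])"
proof -
  let ?S = "{i. Suc i < length (v @ [a]) \<and> order_iso [(v @ [a]) ! i, (v @ [a]) ! Suc i] [y, z]}"
  let ?N = "if order_iso [a, b] [y, z] then {length v} else {}"
  have nth: "(v @ [a, b]) ! i = (v @ [a]) ! i" if "i \<le> length v" for i
    using that by (auto simp: nth_append)
  have "{i. Suc i < length (v @ [a, b]) \<and>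
          order_iso [(v @ [a, b]) ! i, (v @ [a, b]) ! Suc i] [y, z]} = ?S \<union> ?N"
    (is "?L = _")
  proof (rule set_eqI)
    fix i
    consider "i < length v" | "i = length v" | "i > length v" by linarith
    then show "i \<in> ?L \<longleftrightarrow> i \<in> ?S \<union> ?N"
    proof cases
      case 1
      then show ?thesis by (simp add: nth)
    next
      case 2
      then show ?thesis by (simp add: nth_append)
    next
      case 3
      then show ?thesis by simp
    qed
  qed
  moreover have "card (?S \<union> ?N) = card ?S + card ?N"
    by (rule card_Un_disjoint) auto
  ultimately show ?thesis
    by (simp add: adjacent_occurrences_def)
qed

text \<open>A new occurrence must use the last adjacent pair, so \<open>j = length v\<close> and its
  first letter ranges over \<open>v\<close> alone.\<close>

lemma dashed_occurrences_snoc: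
  "dashed_occurrences x y z (v @ [a, b]) =
     dashed_occurrences x y z (v @ [a]) +
     length (filter (\<lambda>c. order_iso [c, a, b] [x, y, z]) v)"
proof -
  let ?S = "{(i, j). i < j \<and> Suc j < length (v @ [a]) \<and>
               order_iso [(v @ [a]) ! i, (v @ [a]) ! j, (v @ [a]) ! Suc j] [x, y, z]}"
  let ?N = "{i. i < length v \<and> order_iso [v ! i, a, b] [x, y, z]}"
  have nth: "(v @ [a, b]) ! i = (v @ [a]) ! i" if "i \<le> length v" for i
    using that by (auto simp: nth_append)
  have "{(i, j). i < j \<and> Suc j < length (v @ [a, b]) \<and>
          order_iso [(v @ [a, b]) ! i, (v @ [a, b]) ! j, (v @ [a, b]) ! Suc j] [x, y, z]} =
        ?S \<union> ?N \<times> {length v}" (is "?L = _")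
  proof (rule set_eqI, clarify)
    fix i j
    consider "j < length v" | "j = length v" | "j > length v" by linarith
    then show "(i, j) \<in> ?L \<longleftrightarrow> (i, j) \<in> ?S \<union> ?N \<times> {length v}"
    proof cases
      case 1
      then show ?thesis by (auto simp: nth)
    next
      case 2
      then show ?thesis by (auto simp: nth_append)
    next
      case 3
      then show ?thesis by simp
    qed
  qed
  moreover have "card (?S \<union> ?N \<times> {length v}) = card ?S + card (?N \<times> {length v})"
  proof (rule card_Un_disjoint)
    show "finite ?S"
      by (rule finite_subset[of _ "{..length v} \<times> {..length v}"]) auto
  qed auto
  ultimately show ?thesis
    by (simp add: dashed_occurrences_def length_filter_conv_card)
qed

lemma order_iso_2:
  "order_iso [a, b] [y, z] \<longleftrightarrow> (a < b \<longleftrightarrow> y < z) \<and> (b < a \<longleftrightarrow> z < y)"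
  by (simp add: order_iso_def All_less_Suc conj_ac)

lemma order_iso_3:
  "order_iso [c, a, b] [x, y, z] \<longleftrightarrow>
     (c < a \<longleftrightarrow> x < y) \<and> (a < c \<longleftrightarrow> y < x) \<and> (c < b \<longleftrightarrow> x < z) \<and> (b < c \<longleftrightarrow> z < x) \<and>
     (a < b \<longleftrightarrow> y < z) \<and> (b < a \<longleftrightarrow> z < y)"
  by (simp add: order_iso_def All_less_Suc conj_ac)

lemma pattern_count_snoc:
  "pattern_count p (v @ [a, b]) = pattern_count p (v @ [a]) + appended_occurrences p v a b"
  by (cases p)
     (auto simp: adjacent_occurrences_snoc dashed_occurrences_snoc order_iso_2 order_iso_3
           intro!: arg_cong[where f = length] filter_cong)

lemma pattern_count_short:
  assumes "length w \<le> 1"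
  shows "pattern_count p w = 0"
  using assms by (cases p) (auto simp: adjacent_occurrences_def dashed_occurrences_def)

lemma appended_occurrences_D:
  assumes "p \<in> patterns_D" "\<not> b < a"
  shows "appended_occurrences p v a b = 0"
  using assms by (auto simp: patterns_D_def)

lemma appended_occurrences_R:
  assumes "p \<in> patterns_R" "\<not> a < b"
  shows "appended_occurrences p v a b = 0"
  using assms by (auto simp: patterns_R_def)

section \<open>Expansion of a weight over chain suffixes\<close>

text \<open>Factor \<open>i\<close> takes as context the whole word before \<open>s ! i\<close>, so
  its increment is the one occurring in the full word \<open>v @ s\<close>.\<close>

definition marked ::
  "('b list \<Rightarrow> 'b \<Rightarrow> 'b \<Rightarrow> 'a) \<Rightarrow> 'b list \<Rightarrow> 'b list \<Rightarrow> 'a::comm_ring_1" where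
  "marked X v s = (\<Prod>i<length s - 1. X (v @ take i s) (s ! i) (s ! Suc i) - 1)"

lemma marked_singleton [simp]: "marked X v [a] = 1"
  by (simp add: marked_def)

lemma marked_snoc:
  "marked X v (s @ [a, b]) = marked X v (s @ [a]) * (X (v @ s) a b - 1)"
  by (auto simp: marked_def nth_append intro!: arg_cong2[where f = "(*)"] prod.cong)

text \<open>Induction on the last letter \<open>b\<close>, with \<open>a\<close> before it. The
  suffix \<open>[b]\<close> contributes \<open>W u\<close>. The longer chain suffixes are those of
  \<open>u\<close> extended by \<open>b\<close>; they exist only if \<open>P a b\<close> and
  contribute \<open>(X v a b - 1) * W u\<close> by the induction hypothesis. The total is
  \<open>X v a b * W u\<close>.\<close>

lemma weight_eq_sum_chain_suffixes:
  fixes W :: "'b list \<Rightarrow> 'a::comm_ring_1"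
  assumes "transp P"
    and W_Nil: "W [] = 1" and W_single: "\<And>a. W [a] = 1"
    and W_snoc: "\<And>v a b. W (v @ [a, b]) = W (v @ [a]) * X v a b"
    and X_1: "\<And>v a b. \<not> P a b \<Longrightarrow> X v a b = 1"
    and "u \<noteq> []"
  shows "W u = (\<Sum>k\<in>{k. k < length u \<and> sorted_wrt P (drop k u)}.
                  W (take k u) * marked X (take k u) (drop k u))"
  using \<open>u \<noteq> []\<close>
proof (induction u rule: rev_induct)
  case Nil
  then show ?case by simp
next
  case (snoc b u)
  let ?K = "\<lambda>u. {k. k < length u \<and> sorted_wrt P (drop k u)}"
  let ?f = "\<lambda>u k. W (take k u) * marked X (take k u) (drop k u)"
  show ?case
  proof (cases u rule: rev_cases)
    case Nil
    have "?K [b] = {0}" by auto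
    with Nil show ?thesis
      by (simp add: W_Nil W_single)
  next
    case (snoc v a)
    have drop: "drop k u = drop k v @ [a]" if "k < length u" for k
      using that snoc by auto
    \<comment> \<open>A suffix of \<open>u\<close> starting at \<open>k < length u\<close> ends in
      \<open>a\<close>, so by transitivity \<open>P a b\<close> is the only comparison left to
      check.\<close>
    have K: "?K (u @ [b]) = insert (length u) (if P a b then ?K u else {})"
    proof (rule set_eqI)
      fix k
      consider "k < length u" | "k = length u" | "k > length u" by linarith
      then show "k \<in> ?K (u @ [b]) \<longleftrightarrow> k \<in> insert (length u) (if P a b then ?K u else {})"
      proof cases
        case 1
        then show ?thesis
          using drop[OF 1] \<open>transp P\<close> by (auto simp: sorted_wrt_append dest: transpD)
      qed auto
    qed
    \<comment> \<open>Prolonging the suffix by \<open>b\<close> adds one factor, whose context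
      \<open>take k v @ drop k v\<close> is \<open>v\<close> for every \<open>k\<close>.\<close>
    have f: "?f (u @ [b]) k = (X v a b - 1) * ?f u k" if "k < length u" for k
    proof -
      have "drop k (u @ [b]) = drop k v @ [a, b]" "take k u = take k v"
        using that snoc by auto
      then show ?thesis
        using that by (simp add: drop marked_snoc mult_ac)
    qed
    have "(\<Sum>k\<in>?K (u @ [b]). ?f (u @ [b]) k) =
            W u + (\<Sum>k\<in>(if P a b then ?K u else {}). ?f (u @ [b]) k)"
      by (subst K) (simp add: sum.insert)
    also have "(\<Sum>k\<in>(if P a b then ?K u else {}). ?f (u @ [b]) k) =
                 (\<Sum>k\<in>(if P a b then ?K u else {}). (X v a b - 1) * ?f u k)"
      by (intro sum.cong refl f) (auto split: if_splits)
    \<comment> \<open>If \<open>P a b\<close> fails, the sum is empty and the right side vanishes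
      because \<open>X v a b = 1\<close>.\<close>
    also have "\<dots> = (X v a b - 1) * W u"
      using X_1[of a b v] snoc.IH snoc by (auto simp: sum_distrib_left)
    finally show ?thesis
      using W_snoc[of v a b] snoc by (simp add: algebra_simps)
  qed
qed

section \<open>Increments in terms of the content\<close>

lemma length_filter_words:
  assumes "w \<in> words n m"
  shows "length (filter p w) = (\<Sum>i\<in>{i\<in>{1..n}. p i}. m i)"
proof -
  have "length (filter p w) = (\<Sum>i\<in>{i\<in>{1..n}. p i}. count_list (filter p w) i)"
    using assms by (intro sum_count_set[symmetric]) (auto simp: words_def)
  also have "\<dots> = (\<Sum>i\<in>{i\<in>{1..n}. p i}. m i)"
  proof (rule sum.cong)
    fix i assume "i \<in> {i\<in>{1..n}. p i}"
    then have "count_list (filter p w) i = count_list w i"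
      by (induction w) auto
    then show "count_list (filter p w) i = m i"
      using assms \<open>i \<in> _\<close> by (simp add: words_def)
  qed simp
  finally show ?thesis .
qed

text \<open>The count in the whole word is fixed by its content, so subtracting the known count in
  the suffix gives the prefix count, whatever the order of the prefix.\<close>

lemma length_filter_prefix:
  assumes "x @ y \<in> words n m" "{i\<in>{1..n}. p i} = I" "length (filter p y) = l"
  shows "length (filter p x) = sum m I - l"
  using length_filter_words[OF assms(1), of p] assms(2,3) by simp

text \<open>
  The exponents in terms of adjacent letters \<open>a, b\<close> of the monotone suffix; \<open>l\<close> is the number of
  letters that follow them.
\<close>

definition exponent_D :: "pattern \<Rightarrow> nat \<Rightarrow> (nat \<Rightarrow> nat) \<Rightarrow> nat \<Rightarrow> nat \<Rightarrow> nat \<Rightarrow> nat" where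
  "exponent_D p n m a b l = (case p of
       BA \<Rightarrow> 1
     | A_CB \<Rightarrow> sum m {1..<b} - l
     | B_CA \<Rightarrow> sum m {b<..<a}
     | C_BA \<Rightarrow> sum m {a<..n}
     | A_BA \<Rightarrow> m b - 1
     | B_BA \<Rightarrow> m a - 1
     | _ \<Rightarrow> 0)"

definition exponent_R :: "pattern \<Rightarrow> nat \<Rightarrow> (nat \<Rightarrow> nat) \<Rightarrow> nat \<Rightarrow> nat \<Rightarrow> nat \<Rightarrow> nat" where
  "exponent_R p n m a b l = (case p of
       AB \<Rightarrow> 1
     | A_BC \<Rightarrow> sum m {1..<a}
     | B_AC \<Rightarrow> sum m {a<..<b}
     | C_AB \<Rightarrow> sum m {b<..n} - l
     | A_AB \<Rightarrow> m a - 1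
     | B_AB \<Rightarrow> m b - 1
     | _ \<Rightarrow> 0)"

text \<open>Subtract from the content what \<open>a # b # y\<close> contributes, where
  \<open>a > b\<close> and \<open>b\<close> exceeds all of \<open>y\<close>: all of \<open>y\<close>
  for \<open>A_CB\<close>, the letter \<open>b\<close> for \<open>A_BA\<close>, the letter
  \<open>a\<close> for \<open>B_BA\<close>, nothing for \<open>B_CA\<close> and
  \<open>C_BA\<close>.\<close>

lemma appended_occurrences_D_eq:
  assumes "p \<in> patterns_D" and w: "x @ a # b # y \<in> words n m" and s: "sorted_wrt (>) (a # b # y)"
  shows "appended_occurrences p x a b = exponent_D p n m a b (length y)"
proof -
  have "a \<in> {1..n}" "b \<in> {1..n}" using w by (auto simp: words_def)
  note pre = length_filter_prefix[OF w]
  have "b < a" and y: "\<And>c. c \<in> set y \<Longrightarrow> c < b" using s by auto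
  have filter: "filter Q y = []" if "\<And>c. c < b \<Longrightarrow> \<not> Q c" for Q
    using that y by (auto simp: filter_empty_conv)
  consider "p = BA" | "p = A_CB" | "p = B_CA" | "p = C_BA" | "p = A_BA" | "p = B_BA"
    using assms(1) by (auto simp: patterns_D_def)
  then show ?thesis
  proof cases
    case 2
    have "length (filter (\<lambda>c. c < b \<and> b < a) x) = sum m {1..<b} - length y"
      using \<open>b < a\<close> \<open>a \<in> _\<close> y by (intro pre) (auto simp: filter_id_conv)
    with 2 show ?thesis by (simp add: exponent_D_def)
  next
    case 3
    \<comment> \<open>The \<open>- 0\<close> fits the form of \<open>length_filter_prefix\<close>:
      no letter of \<open>a # b # y\<close> lies strictly between \<open>b\<close> and
      \<open>a\<close>.\<close>
    have "length (filter (\<lambda>c. b < c \<and> c < a) x) = sum m {b<..<a} - 0"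
      using \<open>b < a\<close> \<open>a \<in> _\<close> by (intro pre) (auto simp: filter)
    with 3 show ?thesis by (simp add: exponent_D_def)
  next
    case 4
    have "length (filter (\<lambda>c. b < a \<and> a < c) x) = sum m {a<..n} - 0"
      using \<open>b < a\<close> by (intro pre) (auto simp: filter)
    with 4 show ?thesis by (simp add: exponent_D_def)
  next
    case 5
    have "length (filter (\<lambda>c. c = b \<and> b < a) x) = sum m {b} - 1"
      using \<open>b < a\<close> \<open>b \<in> _\<close> by (intro pre) (auto simp: filter)
    with 5 show ?thesis by (simp add: exponent_D_def)
  next
    case 6
    have "length (filter (\<lambda>c. c = a \<and> b < a) x) = sum m {a} - 1"
      using \<open>b < a\<close> \<open>a \<in> _\<close> by (intro pre) (auto simp: filter)
    with 6 show ?thesis by (simp add: exponent_D_def)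
  qed (simp add: exponent_D_def \<open>b < a\<close>)
qed

text \<open>Mirror image of the decreasing case: \<open>y\<close> lies above \<open>b\<close>, so it
  is now \<open>C_AB\<close> that loses \<open>length y\<close>.\<close>

lemma appended_occurrences_R_eq:
  assumes "p \<in> patterns_R" and w: "x @ a # b # y \<in> words n m" and s: "sorted_wrt (<) (a # b # y)"
  shows "appended_occurrences p x a b = exponent_R p n m a b (length y)"
proof -
  have "a \<in> {1..n}" "b \<in> {1..n}" using w by (auto simp: words_def)
  note pre = length_filter_prefix[OF w]
  have "a < b" and y: "\<And>c. c \<in> set y \<Longrightarrow> b < c" using s by auto
  have filter: "filter Q y = []" if "\<And>c. b < c \<Longrightarrow> \<not> Q c" for Q
    using that y by (auto simp: filter_empty_conv)
  consider "p = AB" | "p = A_BC" | "p = B_AC" | "p = C_AB" | "p = A_AB" | "p = B_AB"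
    using assms(1) by (auto simp: patterns_R_def)
  then show ?thesis
  proof cases
    case 2
    have "length (filter (\<lambda>c. c < a \<and> a < b) x) = sum m {1..<a} - 0"
      using \<open>a < b\<close> \<open>b \<in> _\<close> by (intro pre) (auto simp: filter)
    with 2 show ?thesis by (simp add: exponent_R_def)
  next
    case 3
    have "length (filter (\<lambda>c. a < c \<and> c < b) x) = sum m {a<..<b} - 0"
      using \<open>a < b\<close> \<open>b \<in> _\<close> by (intro pre) (auto simp: filter)
    with 3 show ?thesis by (simp add: exponent_R_def)
  next
    case 4
    have "length (filter (\<lambda>c. a < b \<and> b < c) x) = sum m {b<..n} - length y"
      using \<open>a < b\<close> y by (intro pre) (auto simp: filter_id_conv)
    with 4 show ?thesis by (simp add: exponent_R_def)
  next
    case 5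
    have "length (filter (\<lambda>c. c = a \<and> a < b) x) = sum m {a} - 1"
      using \<open>a < b\<close> \<open>a \<in> _\<close> by (intro pre) (auto simp: filter)
    with 5 show ?thesis by (simp add: exponent_R_def)
  next
    case 6
    have "length (filter (\<lambda>c. c = b \<and> a < b) x) = sum m {b} - 1"
      using \<open>a < b\<close> \<open>b \<in> _\<close> by (intro pre) (auto simp: filter)
    with 6 show ?thesis by (simp add: exponent_R_def)
  qed (simp add: exponent_R_def \<open>a < b\<close>)
qed

text \<open>In the decreasing suffix, \<open>card T - j - 1\<close> letters follow the pair of the
  \<open>j\<close>-th and \<open>(j + 1)\<close>-th largest elements.\<close>

lemma exponent_eq_exponent_D:
  assumes "p \<in> patterns_D" "j < card T"
  shows "exponent p n m T j =
           exponent_D p n m (nth_largest T j) (nth_largest T (j + 1)) (card T - j - 1)"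
  using assms by (auto simp: patterns_D_def exponent_D_def)

text \<open>In the increasing suffix the \<open>(j + 1)\<close>-th largest element comes first, and
  the \<open>j - 1\<close> largest elements follow the pair.\<close>

lemma exponent_eq_exponent_R:
  assumes "p \<in> patterns_R" "1 \<le> j"
  shows "exponent p n m T j =
           exponent_R p n m (nth_largest T (j + 1)) (nth_largest T j) (j - 1)"
  using assms by (auto simp: patterns_R_def exponent_R_def)

section \<open>Regrouping by the set of letters in the suffix\<close>

lemma count_list_distinct: "distinct s \<Longrightarrow> count_list s i = of_bool (i \<in> set s)"
  by (induction s) auto

text \<open>Positivity of \<open>m\<close> prevents truncation, so lowering the content by one on
  \<open>set s\<close> exactly undoes appending the distinct letters of \<open>s\<close>.\<close>

lemma append_words_iff:
  assumes "distinct s" "set s \<subseteq> {1..n}" "\<forall>i\<in>{1..n}. m i > 0"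
  shows "v @ s \<in> words n m \<longleftrightarrow> v \<in> words n (\<lambda>i. m i - of_bool (i \<in> set s))"
  using assms by (force simp: words_def count_list_distinct)

text \<open>A chain is recovered from its letters by \<open>L\<close>, so cutting \<open>u\<close>
  at \<open>k\<close> amounts to choosing the letter set \<open>T\<close> of the suffix and the
  prefix \<open>v\<close>.\<close>

lemma sum_words_chain_suffixes:
  fixes g :: "nat list \<Rightarrow> nat list \<Rightarrow> 'a::comm_monoid_add"
  assumes L: "\<And>T. finite T \<Longrightarrow> set (L T) = T \<and> distinct (L T) \<and> sorted_wrt P (L T)"
    and L_set: "\<And>s. sorted_wrt P s \<Longrightarrow> L (set s) = s"
    and m: "\<forall>i\<in>{1..n}. m i > 0"
  shows "(\<Sum>u\<in>words n m. \<Sum>k\<in>{k. k < length u \<and> sorted_wrt P (drop k u)}.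
            g (take k u) (drop k u)) =
         (\<Sum>T\<in>{T. T \<noteq> {} \<and> T \<subseteq> {1..n}}.
            \<Sum>v\<in>words n (\<lambda>i. m i - of_bool (i \<in> T)). g v (L T))" (is "?l = ?r")
proof -
  let ?A = "SIGMA u:words n m. {k. k < length u \<and> sorted_wrt P (drop k u)}"
  let ?B = "SIGMA T:{T. T \<noteq> {} \<and> T \<subseteq> {1..n}}. words n (\<lambda>i. m i - of_bool (i \<in> T))"
  have fin: "finite T" if "T \<subseteq> {1..n}" for T
    using that finite_subset by blast
  have "?l = (\<Sum>(u, k)\<in>?A. g (take k u) (drop k u))"
    by (rule sum.Sigma) (auto simp: finite_words)
  also have "\<dots> = (\<Sum>(T, v)\<in>?B. g v (L T))"
  proof -
    let ?i = "\<lambda>(T, v). (v @ L T, length v)" and ?j = "\<lambda>(u, k). (set (drop k u), take k u)"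
    have A: "?i (?j x) = x \<and> ?j x \<in> ?B \<and>
        (case ?j x of (T, v) \<Rightarrow> g v (L T)) = (case x of (u, k) \<Rightarrow> g (take k u) (drop k u))"
      if "x \<in> ?A" for x
    proof -
      obtain u k where x: "x = (u, k)" by (cases x)
      have u: "u \<in> words n m" "k < length u" "sorted_wrt P (drop k u)"
        using that by (auto simp: x)
      note Lk = L_set[OF u(3)]
      have sub: "set (drop k u) \<subseteq> {1..n}"
        using u(1) set_drop_subset[of k u] by (auto simp: words_def)
      \<comment> \<open>The suffix is \<open>L\<close> of its own letter set, so it inherits
        distinctness from \<open>L\<close>.\<close>
      moreover have "distinct (drop k u)"
        using L[of "set (drop k u)"] by (simp add: Lk)
      ultimately have "take k u \<in> words n (\<lambda>i. m i - of_bool (i \<in> set (drop k u)))"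
        using append_words_iff[of "drop k u" n m "take k u"] m u(1) by simp
      then show ?thesis
        using sub u(2) by (simp add: x Lk)
    qed
    have B: "?j (?i y) = y \<and> ?i y \<in> ?A" if "y \<in> ?B" for y
    proof -
      obtain T v where y: "y = (T, v)" by (cases y)
      have T: "T \<noteq> {}" "T \<subseteq> {1..n}" and v: "v \<in> words n (\<lambda>i. m i - of_bool (i \<in> T))"
        using that by (auto simp: y)
      note LT = L[OF fin[OF T(2)]]
      have "v @ L T \<in> words n m"
        using append_words_iff[of "L T" n m v] LT T v m by simp
      \<comment> \<open>This gives the strict bound \<open>length v < length (v @ L T)\<close> on
        the cutting position.\<close>
      moreover have "L T \<noteq> []"
        using LT T by auto
      ultimately show ?thesis
        using LT by (simp add: y)
    qed
    show ?thesis
      by (rule sum.reindex_bij_witness[where i = ?i and j = ?j]) (use A B in blast)+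
  qed
  also have "\<dots> = ?r"
    by (rule sum.Sigma[symmetric]) (auto simp: finite_words)
  finally show ?thesis .
qed

section \<open>The recurrence for an abstract chain order\<close>

text \<open>Serves both families: \<open>P\<close> is \<open>(>)\<close> for \<open>D\<close> and
  \<open>(<)\<close> for \<open>R\<close>, and \<open>L\<close> lists a set in that order. Since
  \<open>E T\<close> does not depend on the prefix, it factors out of the sum over prefixes.\<close>

lemma joint_distribution_recurrence:
  fixes q :: "nat \<Rightarrow> 'a::comm_ring_1"
  assumes n: "n \<ge> 1" and m: "\<forall>i\<in>{1..n}. m i > 0" and "transp P"
    and L: "\<And>T. finite T \<Longrightarrow> set (L T) = T \<and> distinct (L T) \<and> sorted_wrt P (L T)"
    and L_set: "\<And>s. sorted_wrt P s \<Longrightarrow> L (set s) = s"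
    and zero: "\<And>k v a b. k \<in> {1..r} \<Longrightarrow> \<not> P a b \<Longrightarrow> appended_occurrences (\<sigma> k) v a b = 0"
    and E: "\<And>T v. T \<subseteq> {1..n} \<Longrightarrow> v @ L T \<in> words n m \<Longrightarrow>
      marked (\<lambda>v a b. \<Prod>k=1..r. q k ^ appended_occurrences (\<sigma> k) v a b) v (L T) = E T"
  shows "joint_distribution n r (\<lambda>k w. pattern_count (\<sigma> k) w) q m =
    (\<Sum>T\<in>{T. T \<noteq> {} \<and> T \<subseteq> {1..n}}.
       E T * joint_distribution n r (\<lambda>k w. pattern_count (\<sigma> k) w) q (\<lambda>i. m i - of_bool (i \<in> T)))"
proof -
  define W where "W = (\<lambda>w. \<Prod>k=1..r. q k ^ pattern_count (\<sigma> k) w)"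
  define X where "X = (\<lambda>v a b. \<Prod>k=1..r. q k ^ appended_occurrences (\<sigma> k) v a b)"
  have jd: "joint_distribution n r (\<lambda>k w. pattern_count (\<sigma> k) w) q m' = sum W (words n m')" for m'
    by (simp add: joint_distribution_def W_def)
  have "sum W (words n m) =
          (\<Sum>u\<in>words n m. \<Sum>k\<in>{k. k < length u \<and> sorted_wrt P (drop k u)}.
             W (take k u) * marked X (take k u) (drop k u))"
  proof (rule sum.cong[OF refl weight_eq_sum_chain_suffixes[OF \<open>transp P\<close>]])
    show "W (v @ [a, b]) = W (v @ [a]) * X v a b" for v a b
      by (simp add: W_def X_def pattern_count_snoc power_add prod.distrib)
    show "X v a b = 1" if "\<not> P a b" for v a b
      using that by (simp add: X_def zero)
    \<comment> \<open>The letter 1 belongs to the alphabet and has positive multiplicity.\<close>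
    show "u \<noteq> []" if "u \<in> words n m" for u
      using that n m by (auto simp: words_def)
  qed (simp_all add: W_def pattern_count_short)
  also have "\<dots> = (\<Sum>T\<in>{T. T \<noteq> {} \<and> T \<subseteq> {1..n}}.
                    \<Sum>v\<in>words n (\<lambda>i. m i - of_bool (i \<in> T)). W v * marked X v (L T))"
    by (rule sum_words_chain_suffixes[OF L L_set m, where g = "\<lambda>v s. W v * marked X v s"])
  also have "\<dots> = (\<Sum>T\<in>{T. T \<noteq> {} \<and> T \<subseteq> {1..n}}.
                    E T * sum W (words n (\<lambda>i. m i - of_bool (i \<in> T))))"
  proof (rule sum.cong[OF refl])
    fix T assume "T \<in> {T. T \<noteq> {} \<and> T \<subseteq> {1..n}}"
    then have T: "T \<subseteq> {1..n}" by simp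
    then have LT: "set (L T) = T" "distinct (L T)"
      using L[of T] finite_subset by auto
    have "marked X v (L T) = E T" if "v \<in> words n (\<lambda>i. m i - of_bool (i \<in> T))" for v
      unfolding X_def using that T LT m append_words_iff[of "L T" n m v] by (intro E) auto
    then show "(\<Sum>v\<in>words n (\<lambda>i. m i - of_bool (i \<in> T)). W v * marked X v (L T)) =
               E T * sum W (words n (\<lambda>i. m i - of_bool (i \<in> T)))"
      by (simp add: sum_distrib_left mult.commute)
  qed
  finally show ?thesis by (simp add: jd)
qed

section \<open>Marked products as products over the exponents\<close>

lemma split_at_nth: "Suc i < length s \<Longrightarrow> take i s @ s ! i # s ! Suc i # drop (i + 2) s = s"
  by (metis Suc_lessD add_2_eq_Suc' append_take_drop_id Cons_nth_drop_Suc)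

text \<open>In the decreasing list, positions \<open>i\<close> and \<open>Suc i\<close> hold the
  elements of rank \<open>Suc i\<close> and \<open>Suc i + 1\<close>, so factor \<open>i\<close> is
  the one with \<open>j = Suc i\<close>.\<close>

lemma marked_D:
  fixes q :: "nat \<Rightarrow> 'a::comm_ring_1"
  assumes D: "\<forall>k\<in>{1..r}. \<sigma> k \<in> patterns_D"
    and w: "v @ rev (sorted_list_of_set T) \<in> words n m"
  shows "marked (\<lambda>v a b. \<Prod>k=1..r. q k ^ appended_occurrences (\<sigma> k) v a b) v
           (rev (sorted_list_of_set T)) =
         (\<Prod>j=1..card T - 1. (\<Prod>k=1..r. q k ^ exponent (\<sigma> k) n m T j) - 1)"
proof -
  define s where "s = rev (sorted_list_of_set T)"
  have len: "length s = card T" by (simp add: s_def)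
  have sorted: "sorted_wrt (>) s" by (simp add: s_def sorted_wrt_rev)
  have app: "appended_occurrences (\<sigma> k) (v @ take i s) (s ! i) (s ! Suc i) =
               exponent (\<sigma> k) n m T (Suc i)"
    if "i < card T - 1" "k \<in> {1..r}" for i k
  proof -
    have i: "Suc i < length s" using that by (simp add: len)
    note split = split_at_nth[OF i]
    have "(v @ take i s) @ s ! i # s ! Suc i # drop (i + 2) s \<in> words n m"
      using w unfolding append_assoc split by (simp add: s_def)
    moreover have "sorted_wrt (>) (s ! i # s ! Suc i # drop (i + 2) s)"
      using sorted by (subst (asm) split[symmetric]) (simp only: sorted_wrt_append)
    ultimately have "appended_occurrences (\<sigma> k) (v @ take i s) (s ! i) (s ! Suc i) =
        exponent_D (\<sigma> k) n m (s ! i) (s ! Suc i) (length (drop (i + 2) s))"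
      using D that by (intro appended_occurrences_D_eq) auto
    also have "\<dots> = exponent (\<sigma> k) n m T (Suc i)"
      using D that i by (subst exponent_eq_exponent_D) (simp_all add: nth_largest_def s_def)
    finally show ?thesis .
  qed
  have "marked (\<lambda>v a b. \<Prod>k=1..r. q k ^ appended_occurrences (\<sigma> k) v a b) v s =
          (\<Prod>i<card T - 1. (\<Prod>k=1..r. q k ^ exponent (\<sigma> k) n m T (Suc i)) - 1)"
    using app by (simp add: marked_def len)
  also have "\<dots> = (\<Prod>j=1..card T - 1. (\<Prod>k=1..r. q k ^ exponent (\<sigma> k) n m T j) - 1)"
    by (rule prod.reindex_bij_witness[where i = "\<lambda>j. j - 1" and j = Suc]) auto
  finally show ?thesis by (simp add: s_def)
qed

text \<open>The increasing list runs through the ranks backwards, so factor \<open>i\<close> is the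
  one with \<open>j = card T - 1 - i\<close>.\<close>

lemma marked_R:
  fixes q :: "nat \<Rightarrow> 'a::comm_ring_1"
  assumes R: "\<forall>k\<in>{1..r}. \<sigma> k \<in> patterns_R"
    and w: "v @ sorted_list_of_set T \<in> words n m"
  shows "marked (\<lambda>v a b. \<Prod>k=1..r. q k ^ appended_occurrences (\<sigma> k) v a b) v
           (sorted_list_of_set T) =
         (\<Prod>j=1..card T - 1. (\<Prod>k=1..r. q k ^ exponent (\<sigma> k) n m T j) - 1)"
proof -
  define s where "s = sorted_list_of_set T"
  have len: "length s = card T" by (simp add: s_def)
  have sorted: "sorted_wrt (<) s" by (simp add: s_def)
  have nth: "nth_largest T j = s ! (card T - j)" if "1 \<le> j" "j \<le> card T" for j
    using that by (simp add: nth_largest_def rev_nth s_def)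
  have app: "appended_occurrences (\<sigma> k) (v @ take i s) (s ! i) (s ! Suc i) =
               exponent (\<sigma> k) n m T (card T - 1 - i)"
    if "i < card T - 1" "k \<in> {1..r}" for i k
  proof -
    have i: "Suc i < length s" using that by (simp add: len)
    note split = split_at_nth[OF i]
    have "(v @ take i s) @ s ! i # s ! Suc i # drop (i + 2) s \<in> words n m"
      using w unfolding append_assoc split by (simp add: s_def)
    moreover have "sorted_wrt (<) (s ! i # s ! Suc i # drop (i + 2) s)"
      using sorted by (subst (asm) split[symmetric]) (simp only: sorted_wrt_append)
    ultimately have "appended_occurrences (\<sigma> k) (v @ take i s) (s ! i) (s ! Suc i) =
        exponent_R (\<sigma> k) n m (s ! i) (s ! Suc i) (length (drop (i + 2) s))"
      using R that by (intro appended_occurrences_R_eq) auto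
    also have "\<dots> = exponent (\<sigma> k) n m T (card T - 1 - i)"
    proof -
      \<comment> \<open>These locate the elements of rank \<open>j + 1\<close> and \<open>j\<close>
        at positions \<open>i\<close> and \<open>Suc i\<close> for
        \<open>j = card T - 1 - i\<close>.\<close>
      have "card T - (card T - 1 - i + 1) = i" "card T - (card T - 1 - i) = Suc i"
        using that by auto
      then show ?thesis
        using R that by (subst exponent_eq_exponent_R) (simp_all add: nth len)
    qed
    finally show ?thesis .
  qed
  have "marked (\<lambda>v a b. \<Prod>k=1..r. q k ^ appended_occurrences (\<sigma> k) v a b) v s =
          (\<Prod>i<card T - 1. (\<Prod>k=1..r. q k ^ exponent (\<sigma> k) n m T (card T - 1 - i)) - 1)"
    using app by (simp add: marked_def len)
  also have "\<dots> = (\<Prod>j=1..card T - 1. (\<Prod>k=1..r. q k ^ exponent (\<sigma> k) n m T j) - 1)"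
    by (rule prod.reindex_bij_witness[where i = "\<lambda>j. card T - 1 - j" and j = "\<lambda>i. card T - 1 - i"])
       auto
  finally show ?thesis by (simp add: s_def)
qed

section \<open>Reversal and assembly\<close>

lemma sorted_list_of_set_chain:
  fixes s :: "nat list"
  assumes "sorted_wrt (<) s"
  shows "sorted_list_of_set (set s) = s"
  using assms by (simp add: strict_sorted_iff sorted_list_of_set.idem_if_sorted_distinct)

text \<open>Reversal is an involution on words that preserves letter counts, so it permutes
  \<open>words n m\<close>.\<close>

lemma joint_distribution_rev:
  "joint_distribution n r (\<lambda>k w. s k (rev w)) q m = joint_distribution n r s q m"
  unfolding joint_distribution_def
  by (rule sum.reindex_bij_witness[where i = rev and j = rev]) (auto simp: words_def count_list_rev)

theorem mainTheorem3:
  fixes n r :: nat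
    and \<sigma> :: "nat \<Rightarrow> pattern"
    and q :: "nat \<Rightarrow> 'a::comm_ring_1"
    and m :: "nat \<Rightarrow> nat"
  assumes "n \<ge> 1" and "r \<ge> 1"
    and "(\<forall>k\<in>{1..r}. \<sigma> k \<in> patterns_D) \<or> (\<forall>k\<in>{1..r}. \<sigma> k \<in> patterns_R)"
    and "\<forall>i\<in>{1..n}. m i > 0"
  shows
      "joint_distribution n r (\<lambda>k w. pattern_count (\<sigma> k) w) q m =
          (\<Sum>T\<in>{T. T \<noteq> {} \<and> T \<subseteq> {1..n}}.
            (\<Prod>j=1..card T - 1. (\<Prod>k=1..r. q k ^ exponent (\<sigma> k) n m T j) - 1) *
            joint_distribution n r (\<lambda>k w. pattern_count (\<sigma> k) w) q (\<lambda>i. m i - of_bool (i \<in> T))) \<and>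
       joint_distribution n r (\<lambda>k w. pattern_count (\<sigma> k) (rev w)) q m =
          (\<Sum>T\<in>{T. T \<noteq> {} \<and> T \<subseteq> {1..n}}.
            (\<Prod>j=1..card T - 1. (\<Prod>k=1..r. q k ^ exponent (\<sigma> k) n m T j) - 1) *
            joint_distribution n r (\<lambda>k w. pattern_count (\<sigma> k) (rev w)) q (\<lambda>i. m i - of_bool (i \<in> T)))"
proof -
  have "joint_distribution n r (\<lambda>k w. pattern_count (\<sigma> k) w) q m =
          (\<Sum>T\<in>{T. T \<noteq> {} \<and> T \<subseteq> {1..n}}.
            (\<Prod>j=1..card T - 1. (\<Prod>k=1..r. q k ^ exponent (\<sigma> k) n m T j) - 1) *
            joint_distribution n r (\<lambda>k w. pattern_count (\<sigma> k) w) q (\<lambda>i. m i - of_bool (i \<in> T)))"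
    using assms(3)
  proof
    assume D: "\<forall>k\<in>{1..r}. \<sigma> k \<in> patterns_D"
    show ?thesis
    proof (rule joint_distribution_recurrence[where P = "(>)" and
          L = "\<lambda>T. rev (sorted_list_of_set T)", OF \<open>n \<ge> 1\<close> assms(4)])
      show "rev (sorted_list_of_set (set s)) = s" if "sorted_wrt (>) s" for s :: "nat list"
        using sorted_list_of_set_chain[of "rev s"] that by (simp add: sorted_wrt_rev)
    qed (use D in \<open>simp_all add: sorted_wrt_rev appended_occurrences_D marked_D
          del: One_nat_def\<close>)
  next
    assume R: "\<forall>k\<in>{1..r}. \<sigma> k \<in> patterns_R"
    show ?thesis
      by (rule joint_distribution_recurrence[where P = "(<)" and L = sorted_list_of_set,
            OF \<open>n \<ge> 1\<close> assms(4)])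
         (use R in \<open>simp_all add: sorted_list_of_set_chain appended_occurrences_R marked_R
            del: One_nat_def\<close>)
  qed
  \<comment> \<open>Each reversed distribution equals the unreversed one, also at the lowered
    contents, so the second recurrence becomes the first.\<close>
  then show ?thesis
    by (simp only: joint_distribution_rev[where s = "\<lambda>k w. pattern_count (\<sigma> k) w"] simp_thms)
qed

end
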